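(* Let $(A,\mu)$ be an anti-associative algebra over $\mathbb{K}$, and let $\psi(x,y)=[x,y]$ and $\rho(x,y)=x\bullet y$ be the skew-symmetric and symmetric maps attached to $\mu$. Then: (1) $(A,\rho)$ is a Jacobi-Jordan algebra; (2) $(A,\rho)$ acts by antiderivations on the skew-symmetric algebra $(A,\psi)$; that is, for all $x,y,z\in A$, $$x\bullet[y,z]=-[x\bullet y,z]-[y,x\bullet z].$$
   Context: $\mathbb{K}$ is a field of characteristic $0$. An algebra $(A,\mu)$ (a $\mathbb{K}$-vector space with a bilinear multiplication) is anti-associative if $\mu(\mu(x,y),z)+\mu(x,\mu(y,z))=0$ for all $x,y,z\in A$. The maps attached to $\mu$ by polarization are $\rho(x,y)=\frac12(\mu(x,y)+\mu(y,x))$ and $\psi(x,y)=\frac12(\mu(x,y)-\mu(y,x))$. A Jacobi-Jordan algebra is an algebra $(A,\rho)$ with $\rho$ commutative and $\rho(x,\rho(y,z))+\rho(y,\rho(z,x))+\rho(z,\rho(x,y))=0$ for all $x,y,z\in A$. An antiderivation of an algebra $(A,\nu)$ is a linear map $f$ with $f(\nu(x,y))+\nu(x,f(y))+\nu(f(x),y)=0$. *)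

theory Defs
  imports Complex_Main
begin

locale nonassociative_algebra = vector_space scale
  for scale :: "'k::field \<Rightarrow> 'a::ab_group_add \<Rightarrow> 'a" +
  fixes mult :: "'a \<Rightarrow> 'a \<Rightarrow> 'a"
  assumes linear_left: "\<And>y. Vector_Spaces.linear scale scale (\<lambda>x. mult x y)"
    and linear_right: "\<And>x. Vector_Spaces.linear scale scale (\<lambda>y. mult x y)"

locale anti_associative_algebra = nonassociative_algebra scale mult
  for scale :: "'k::field \<Rightarrow> 'a::ab_group_add \<Rightarrow> 'a"
    and mult :: "'a \<Rightarrow> 'a \<Rightarrow> 'a" +
  assumes anti_associative: "mult (mult x y) z + mult x (mult y z) = 0"

locale jacobi_jordan_algebra = nonassociative_algebra scale mult
  for scale :: "'k::field \<Rightarrow> 'a::ab_group_add \<Rightarrow> 'a"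
    and mult :: "'a \<Rightarrow> 'a \<Rightarrow> 'a" +
  assumes commutative: "mult x y = mult y x"
    and jacobi: "mult x (mult y z) + mult y (mult z x) + mult z (mult x y) = 0"

locale skew_symmetric_algebra = nonassociative_algebra scale mult
  for scale :: "'k::field \<Rightarrow> 'a::ab_group_add \<Rightarrow> 'a"
    and mult :: "'a \<Rightarrow> 'a \<Rightarrow> 'a" +
  assumes skew_symmetric: "mult x y = - mult y x"

definition antiderivation ::
  "('k::field \<Rightarrow> 'a::ab_group_add \<Rightarrow> 'a) \<Rightarrow> ('a \<Rightarrow> 'a \<Rightarrow> 'a) \<Rightarrow> ('a \<Rightarrow> 'a) \<Rightarrow> bool" where
  "antiderivation scale mult f \<longleftrightarrow>
     Vector_Spaces.linear scale scale f \<and>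
     (\<forall>x y. f (mult x y) + mult x (f y) + mult (f x) y = 0)"

text \<open>The factor \<open>1 / 2\<close> is meaningful only when the field does not have characteristic 2.\<close>

definition symmetric_part ::
  "('k::field \<Rightarrow> 'a::ab_group_add \<Rightarrow> 'a) \<Rightarrow> ('a \<Rightarrow> 'a \<Rightarrow> 'a) \<Rightarrow> 'a \<Rightarrow> 'a \<Rightarrow> 'a" where
  "symmetric_part scale mult x y = scale (1 / 2) (mult x y + mult y x)"

definition skew_symmetric_part ::
  "('k::field \<Rightarrow> 'a::ab_group_add \<Rightarrow> 'a) \<Rightarrow> ('a \<Rightarrow> 'a \<Rightarrow> 'a) \<Rightarrow> 'a \<Rightarrow> 'a \<Rightarrow> 'a" where
  "skew_symmetric_part scale mult x y = scale (1 / 2) (mult x y - mult y x)"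

end

theory Submission
  imports Defs
begin

text \<open>
  Anti-associativity rewrites each of the twelve products of three elements as \<open>\<plusminus> a(bc)\<close>. After this
  normalization both identities are sums in which every monomial occurs once with each sign.
\<close>

context nonassociative_algebra
begin

lemma mult_add_left: "mult (x + y) z = mult x z + mult y z"
  using linear_left[of z] by (simp add: Vector_Spaces.linear_iff)

lemma mult_add_right: "mult x (y + z) = mult x y + mult x z"
  using linear_right[of x] by (simp add: Vector_Spaces.linear_iff)

lemma mult_scale_left: "mult (scale c x) y = scale c (mult x y)"
  using linear_left[of y] by (simp add: Vector_Spaces.linear_iff)

lemma mult_scale_right: "mult x (scale c y) = scale c (mult x y)"
  using linear_right[of x] by (simp add: Vector_Spaces.linear_iff)

lemma mult_diff_left: "mult (x - y) z = mult x z - mult y z"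
  by (metis add_diff_cancel_right' diff_add_cancel mult_add_left)

lemma mult_diff_right: "mult x (y - z) = mult x y - mult x z"
  by (metis add_diff_cancel_right' diff_add_cancel mult_add_right)

text \<open>These rules expand a product of two polarized expressions into monomials and pull the
  factors \<open>1 / 2\<close> to the outside.\<close>

lemmas mult_linear = mult_add_left mult_add_right mult_diff_left mult_diff_right
  mult_scale_left mult_scale_right

lemma nonassociative_algebra_symmetric_part:
  "nonassociative_algebra scale (symmetric_part scale mult)"
  by unfold_locales
    (simp_all add: symmetric_part_def Vector_Spaces.linear_iff vector_space_axioms mult_linear
      scale_right_distrib mult.commute algebra_simps)

lemma nonassociative_algebra_skew_symmetric_part:
  "nonassociative_algebra scale (skew_symmetric_part scale mult)"
  by unfold_locales
    (simp_all add: skew_symmetric_part_def Vector_Spaces.linear_iff vector_space_axioms mult_linear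
      scale_right_distrib scale_right_diff_distrib mult.commute algebra_simps)

lemma skew_symmetric_algebra_skew_symmetric_part:
  "skew_symmetric_algebra scale (skew_symmetric_part scale mult)"
proof (intro skew_symmetric_algebra.intro nonassociative_algebra_skew_symmetric_part
    skew_symmetric_algebra_axioms.intro)
  show "skew_symmetric_part scale mult x y = - skew_symmetric_part scale mult y x" for x y
    by (simp add: skew_symmetric_part_def scale_right_diff_distrib)
qed

end

context anti_associative_algebra
begin

text \<open>Oriented as a rewrite rule, this moves brackets to the right, so \<open>a(bc)\<close> is
  the normal form of a triple product.\<close>

lemma mult_assoc_minus: "mult (mult x y) z = - mult x (mult y z)"
  using anti_associative by (simp add: eq_neg_iff_add_eq_0)

lemma jacobi_jordan_algebra_symmetric_part:
  "jacobi_jordan_algebra scale (symmetric_part scale mult)"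
proof (intro jacobi_jordan_algebra.intro nonassociative_algebra_symmetric_part
    jacobi_jordan_algebra_axioms.intro)
  let ?r = "symmetric_part scale mult"
  show "?r x y = ?r y x" for x y
    by (simp add: symmetric_part_def add.commute)
  \<comment> \<open>Up to the factor 1/4, the first summand becomes x(yz) + x(zy) - y(zx) - z(yx).
    The positive terms of the cyclic sum run through all six orderings of x, y, z, and so do the
    negative ones.\<close>
  show "?r x (?r y z) + ?r y (?r z x) + ?r z (?r x y) = 0" for x y z
    by (simp add: symmetric_part_def mult_linear mult_assoc_minus scale_right_distrib
        scale_right_diff_distrib)
qed

lemma antiderivation_symmetric_part:
  "antiderivation scale (skew_symmetric_part scale mult) (symmetric_part scale mult x)"
  unfolding antiderivation_def
proof (intro conjI allI)
  show "Vector_Spaces.linear scale scale (symmetric_part scale mult x)"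
    using nonassociative_algebra.linear_right[OF nonassociative_algebra_symmetric_part] .
  \<comment> \<open>Up to the factor 1/4, the three summands become x(yz) - x(zy) - y(zx) + z(yx),
    y(xz) + y(zx) + x(zy) + z(xy) and -x(yz) - y(xz) - z(xy) - z(yx).\<close>
  show "symmetric_part scale mult x (skew_symmetric_part scale mult y z)
      + skew_symmetric_part scale mult y (symmetric_part scale mult x z)
      + skew_symmetric_part scale mult (symmetric_part scale mult x y) z = 0" for y z
    by (simp add: symmetric_part_def skew_symmetric_part_def mult_linear mult_assoc_minus
        scale_right_distrib scale_right_diff_distrib)
qed

end

text \<open>In characteristic zero \<open>1 / 2\<close> is a true inverse of two, so \<mu> = \<rho>
  + \<psi>. The third conjunct expresses the action by antiderivations, and the last one solves its
  defining equation for the outer term.\<close>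

theorem proposition35:
  fixes scale :: "'k::field_char_0 \<Rightarrow> 'a::ab_group_add \<Rightarrow> 'a"
    and \<mu> \<rho> \<psi> :: "'a \<Rightarrow> 'a \<Rightarrow> 'a"
  assumes "anti_associative_algebra scale \<mu>"
    and "\<rho> = symmetric_part scale \<mu>"
    and "\<psi> = skew_symmetric_part scale \<mu>"
  shows "jacobi_jordan_algebra scale \<rho> \<and>
    skew_symmetric_algebra scale \<psi> \<and>
    (\<forall>x. antiderivation scale \<psi> (\<rho> x)) \<and>
    (\<forall>x y z. \<rho> x (\<psi> y z) = - \<psi> (\<rho> x y) z - \<psi> y (\<rho> x z))"
proof -
  interpret anti_associative_algebra scale \<mu> by fact
  have anti: "antiderivation scale \<psi> (\<rho> x)" for x
    unfolding assms(2,3) by (rule antiderivation_symmetric_part)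
  then have "\<rho> x (\<psi> y z) + \<psi> y (\<rho> x z) + \<psi> (\<rho> x y) z = 0" for x y z
    by (simp add: antiderivation_def)
  then have "\<rho> x (\<psi> y z) = - \<psi> (\<rho> x y) z - \<psi> y (\<rho> x z)" for x y z
    \<comment> \<open>Pure abelian group rearrangement: a + b + c = 0 gives a = -c - b.\<close>
    by (metis add.assoc add.commute eq_neg_iff_add_eq_0 minus_add_distrib diff_conv_add_uminus)
  with anti show ?thesis
    using jacobi_jordan_algebra_symmetric_part skew_symmetric_algebra_skew_symmetric_part
    by (simp add: assms(2,3))
qed

end
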